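(* Let $L$ be a finite-dimensional cyclic Leibniz algebra over an infinite field $F$, and let $L^*$ be a finite-dimensional Leibniz algebra over $F$ for which there is a lattice isomorphism from $L$ to $L^*$. Then $L^*$ is also a cyclic Leibniz algebra, of the same dimension as $L$.
   Context: A (right) Leibniz algebra over a field $F$ is an $F$-vector space $L$ with a bilinear product satisfying $[x,[y,z]]=[[x,y],z]-[[x,z],y]$ for all $x,y,z\in L$. The set $\mathcal{L}(L)$ of all subalgebras of $L$ is a lattice, where $A\cap B$ is the usual intersection and $A\cup B$ denotes the subalgebra generated by the set-theoretic union of $A$ and $B$. A lattice isomorphism from $L$ to $L^*$ is a bijective map $\theta:\mathcal{L}(L)\to\mathcal{L}(L^* )$ such that $\theta(A\cup B)=\theta(A)\cup\theta(B)$ and $\theta(A\cap B)=\theta(A)\cap\theta(B)$ for all $A,B\in\mathcal{L}(L)$. A Leibniz algebra $L$ is called cyclic if it is generated by a single element $x$; in this case $L$ has a basis $x,x^2,\ldots,x^n$ ($n>1$), with products $[x^i,x]=x^{i+1}$ for $1\le i\le n-1$ and $[x^n,x]=\alpha_2x^2+\cdots+\alpha_nx^n$ for some $\alpha_i\in F$, all other products of basis elements being zero. *)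

theory Defs
  imports Complex_Main
begin

text \<open>Right Leibniz algebras over a field; the underlying space is the whole type \<open>'b\<close>.\<close>

locale leibniz_algebra = vector_space scale
  for scale :: "'a::field \<Rightarrow> 'b::ab_group_add \<Rightarrow> 'b" +
  fixes bracket :: "'b \<Rightarrow> 'b \<Rightarrow> 'b"
  assumes linear_left: "Vector_Spaces.linear scale scale (\<lambda>x. bracket x y)"
    and linear_right: "Vector_Spaces.linear scale scale (\<lambda>y. bracket x y)"
    and leibniz: "bracket x (bracket y z) = bracket (bracket x y) z - bracket (bracket x z) y"
begin

definition subalgebra :: "'b set \<Rightarrow> bool" where
  "subalgebra S \<longleftrightarrow> subspace S \<and> (\<forall>x\<in>S. \<forall>y\<in>S. bracket x y \<in> S)"

definition generated :: "'b set \<Rightarrow> 'b set" where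
  "generated S = subalgebra hull S"

text \<open>No lower bound on the dimension is imposed, so the zero algebra and the
  one-dimensional algebra also count as cyclic.\<close>

definition cyclic :: bool where
  "cyclic \<longleftrightarrow> (\<exists>x. generated {x} = UNIV)"

end

locale leibniz_algebra_pair =
  L1: leibniz_algebra scale1 bracket1 + L2: leibniz_algebra scale2 bracket2
  for scale1 :: "'a::field \<Rightarrow> 'b::ab_group_add \<Rightarrow> 'b" and bracket1 :: "'b \<Rightarrow> 'b \<Rightarrow> 'b"
    and scale2 :: "'a::field \<Rightarrow> 'c::ab_group_add \<Rightarrow> 'c" and bracket2 :: "'c \<Rightarrow> 'c \<Rightarrow> 'c"
begin

definition lattice_isomorphism :: "('b set \<Rightarrow> 'c set) \<Rightarrow> bool" where
  "lattice_isomorphism \<theta> \<longleftrightarrow>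
     bij_betw \<theta> {A. L1.subalgebra A} {A. L2.subalgebra A} \<and>
     (\<forall>A B. L1.subalgebra A \<and> L1.subalgebra B \<longrightarrow>
        \<theta> (L1.generated (A \<union> B)) = L2.generated (\<theta> A \<union> \<theta> B) \<and>
        \<theta> (A \<inter> B) = \<theta> A \<inter> \<theta> B)"

end

end

theory Submission
  imports Defs
begin

text \<open>
  Let \<open>L\<close> be generated by \<open>x\<close>, let \<open>M\<close> be the set of all \<open>m\<close> with \<open>[y, m] = 0\<close> for every \<open>y\<close>,
  and let \<open>R = [-, x]\<close>. Then \<open>L = F x + M\<close>, every subspace of \<open>M\<close> is a subalgebra, every
  \<open>R\<close>-invariant subspace is a subalgebra, and every subalgebra not contained in \<open>M\<close> is
  \<open>R\<close>-invariant. Hence the maximal subalgebras are maximal submodules of \<open>L\<close> seen as a cyclic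
  module over the polynomials in \<open>R\<close>; as over an Artinian ring, there are only finitely many of
  them. So \<open>L\<^sup>*\<close> has finitely many maximal subalgebras, and over an infinite field they do not
  cover \<open>L\<^sup>*\<close>; any element outside all of them generates \<open>L\<^sup>*\<close>. The dimension of a cyclic algebra is
  the length of its lattice of subalgebras, because \<open>M\<close> has codimension at most one.
\<close>

section \<open>Finite unions of proper subspaces over an infinite field\<close>

context vector_space
begin

lemma linear_self_iff:
  "Vector_Spaces.linear scale scale f \<longleftrightarrow>
     (\<forall>u v. f (u + v) = f u + f v) \<and> (\<forall>c u. f (scale c u) = scale c (f u))"
  by (simp add: linear_iff_module_hom module_hom_iff module_axioms)

text \<open>Induction on the family. If the vector \<open>v\<close> found so far lies in the new
  subspace \<open>W\<close>, take \<open>w\<close> outside \<open>W\<close>: the line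
  \<open>w + scale c v\<close> misses \<open>W\<close> and meets each other subspace in at most one
  point, so some scalar \<open>c\<close> remains.\<close>

lemma finite_union_proper_subspaces:
  assumes "infinite (UNIV :: 'a set)" "finite \<F>"
    and "\<And>W. W \<in> \<F> \<Longrightarrow> subspace W \<and> W \<noteq> UNIV"
  shows "\<exists>v. \<forall>W\<in>\<F>. v \<notin> W"
  using assms(2,3)
proof (induction \<F> rule: finite_induct)
  case empty
  then show ?case by simp
next
  case (insert W \<F>)
  then obtain v where v: "\<forall>U\<in>\<F>. v \<notin> U" by blast
  show ?case
  proof (cases "v \<in> W")
    case False
    with v show ?thesis by auto
  next
    case True
    obtain w where w: "w \<notin> W" using insert.prems by blast
    have inj: "c = d" if "U \<in> \<F>" "w + scale c v \<in> U" "w + scale d v \<in> U" for U c d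
    proof (rule ccontr)
      assume "c \<noteq> d"
      have U: "subspace U" using insert.prems that(1) by blast
      have "scale (c - d) v \<in> U"
        using subspace_diff[OF U that(2,3)] by (simp add: scale_left_diff_distrib)
      from subspace_scale[OF U this, of "inverse (c - d)"] have "v \<in> U" using \<open>c \<noteq> d\<close> by simp
      with v that(1) show False by blast
    qed
    have "finite {c. w + scale c v \<in> U}" if "U \<in> \<F>" for U
    proof (cases "\<exists>d. w + scale d v \<in> U")
      case True
      then obtain d where "w + scale d v \<in> U" by blast
      then have "{c. w + scale c v \<in> U} \<subseteq> {d}" using inj[OF that] by blast
      then show ?thesis by (rule finite_subset) simp
    qed simp
    then have "finite (\<Union>U\<in>\<F>. {c. w + scale c v \<in> U})" using insert.hyps by blast
    then obtain c where c: "c \<notin> (\<Union>U\<in>\<F>. {c. w + scale c v \<in> U})"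
      using assms(1) ex_new_if_finite by blast
    have W: "subspace W" using insert.prems by blast
    have "w + scale c v \<notin> W"
      using subspace_diff[OF W _ subspace_scale[OF W True, of c], of "w + scale c v"] w by auto
    with c show ?thesis by auto
  qed
qed

end

section \<open>Subalgebras, maximal subalgebras and the right annihilator\<close>

context leibniz_algebra
begin

lemma bracket_add_left: "bracket (x + y) z = bracket x z + bracket y z"
  and bracket_scale_left: "bracket (scale c x) z = scale c (bracket x z)"
  and bracket_add_right: "bracket z (x + y) = bracket z x + bracket z y"
  and bracket_scale_right: "bracket z (scale c x) = scale c (bracket z x)"
  and bracket_zero_right: "bracket z 0 = 0"
  using module_hom.add[OF linear_left[of z, unfolded linear_iff_module_hom]]
    module_hom.scale[OF linear_left[of z, unfolded linear_iff_module_hom]]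
    linear_right[of z]
  by (simp_all add: linear_iff_module_hom module_hom.add module_hom.scale module_hom.zero)

lemma bracket_zero_left: "bracket 0 z = 0"
  using bracket_scale_left[of 0 0 z] by simp

lemma subalgebra_UNIV: "subalgebra UNIV"
  by (simp add: subalgebra_def)

lemma subalgebra_Int: "subalgebra A \<Longrightarrow> subalgebra B \<Longrightarrow> subalgebra (A \<inter> B)"
  by (auto simp: subalgebra_def subspace_inter)

lemma subalgebra_generated: "subalgebra (generated S)"
  unfolding generated_def by (rule hull_in) (auto simp: subalgebra_def intro!: subspace_Inter)

lemma generated_superset: "S \<subseteq> generated S"
  unfolding generated_def by (rule hull_subset)

lemma generated_minimal: "S \<subseteq> A \<Longrightarrow> subalgebra A \<Longrightarrow> generated S \<subseteq> A"
  unfolding generated_def by (rule hull_minimal)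

definition maximal_subalgebra :: "'b set \<Rightarrow> bool" where
  "maximal_subalgebra A \<longleftrightarrow>
     subalgebra A \<and> A \<noteq> UNIV \<and> (\<forall>B. subalgebra B \<and> A \<subseteq> B \<longrightarrow> B = A \<or> B = UNIV)"

definition right_annihilator :: "'b set" where
  "right_annihilator = {m. \<forall>y. bracket y m = 0}"

lemma subspace_right_annihilator: "subspace right_annihilator"
  unfolding right_annihilator_def
  by (rule subspaceI) (auto simp: bracket_add_right bracket_scale_right bracket_zero_right)

lemma subalgebra_subspace_right_annihilator:
  assumes "subspace S" "S \<subseteq> right_annihilator"
  shows "subalgebra S"
  using assms subspace_0[OF assms(1)] unfolding subalgebra_def right_annihilator_def by auto

text \<open>With equal second and third arguments the two terms on the right of the Leibniz identity
  cancel.\<close>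

lemma bracket_self_annihilator: "bracket a a \<in> right_annihilator"
  by (simp add: right_annihilator_def leibniz)

lemma bracket_annihilator: "m \<in> right_annihilator \<Longrightarrow> bracket m a \<in> right_annihilator"
  by (simp add: right_annihilator_def leibniz bracket_zero_left)

end

section \<open>Maximal subalgebras in finite dimension and cyclicity\<close>

locale finite_dimensional_leibniz_algebra =
  leibniz_algebra scale bracket + finite_dimensional_vector_space scale Basis
  for scale :: "'a::field \<Rightarrow> 'b::ab_group_add \<Rightarrow> 'b" and bracket :: "'b \<Rightarrow> 'b \<Rightarrow> 'b"
    and Basis :: "'b set"
begin

lemma subspace_dim_psubset:
  assumes "subspace A" "subspace B" "A \<subset> B"
  shows "dim A < dim B"
  using dim_psubset[of A B] assms by (simp only: span_eq_iff[THEN iffD2])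

text \<open>Among the proper subalgebras containing \<open>A\<close>, one of greatest dimension is
  maximal.\<close>

lemma subset_maximal_subalgebra:
  assumes "subalgebra A" "A \<noteq> UNIV"
  shows "\<exists>B. maximal_subalgebra B \<and> A \<subseteq> B"
proof -
  define P where "P B \<longleftrightarrow> subalgebra B \<and> B \<noteq> UNIV \<and> A \<subseteq> B" for B
  have "P A" using assms by (simp add: P_def)
  moreover have "\<forall>B. P B \<longrightarrow> dim B < Suc (dim (UNIV :: 'b set))"
    by (metis dim_subset le_imp_less_Suc subset_UNIV)
  ultimately obtain B where B: "P B" "\<And>C. P C \<Longrightarrow> dim C \<le> dim B"
    using ex_has_greatest_nat[of P A dim] by blast
  have "C = B \<or> C = UNIV" if "subalgebra C" "B \<subseteq> C" for C
  proof (rule ccontr)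
    assume "\<not> ?thesis"
    then have "P C" "B \<subset> C" using that B(1) by (auto simp: P_def)
    then have "dim B < dim C"
      using subspace_dim_psubset B(1) by (simp add: P_def subalgebra_def)
    with B(2)[OF \<open>P C\<close>] show False by simp
  qed
  then have "maximal_subalgebra B" using B(1) by (auto simp: P_def maximal_subalgebra_def)
  with B(1) show ?thesis by (auto simp: P_def)
qed

lemma cyclic_if_finite_maximal_subalgebras:
  assumes "infinite (UNIV :: 'a set)" "finite {A. maximal_subalgebra A}"
  shows cyclic
proof -
  have "\<exists>z. \<forall>A\<in>{A. maximal_subalgebra A}. z \<notin> A"
    using assms
    by (rule finite_union_proper_subspaces) (auto simp: maximal_subalgebra_def subalgebra_def)
  then obtain z where z: "\<And>A. maximal_subalgebra A \<Longrightarrow> z \<notin> A" by blast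
  have "generated {z} = UNIV"
  proof (rule ccontr)
    assume "generated {z} \<noteq> UNIV"
    then obtain B where "maximal_subalgebra B" "generated {z} \<subseteq> B"
      using subset_maximal_subalgebra[OF subalgebra_generated] by blast
    then show False using z generated_superset[of "{z}"] by blast
  qed
  then show ?thesis unfolding cyclic_def by blast
qed

end

section \<open>Decomposition of a cyclic algebra and the length of its subalgebra lattice\<close>

locale cyclic_leibniz_algebra = finite_dimensional_leibniz_algebra +
  fixes x
  assumes generator: "generated {x} = UNIV"
begin

lemma subalgebra_generator: "subalgebra A \<Longrightarrow> x \<in> A \<Longrightarrow> A = UNIV"
  using generated_minimal[of "{x}" A] generator by (simp add: top.extremum_unique)

text \<open>The sum \<open>?A\<close> of the line through \<open>x\<close> and the right annihilator
  contains \<open>x\<close> and is closed under the bracket, so it is everything.\<close>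

lemma generator_annihilator_decomposition:
  "\<exists>\<beta>. \<exists>m\<in>right_annihilator. a = scale \<beta> x + m"
proof -
  let ?M = "right_annihilator"
  let ?A = "{scale \<beta> x + m |\<beta> m. m \<in> ?M}"
  have M: "subspace ?M" by (rule subspace_right_annihilator)
  have MA: "?M \<subseteq> ?A" 
  proof
    fix m assume "m \<in> ?M"
    then show "m \<in> ?A" by (intro CollectI exI[of _ 0] exI[of _ m]) simp
  qed
  have "?A = {u + v |u v. u \<in> span {x} \<and> v \<in> ?M}"
    by (auto simp: span_singleton)
  then have "subspace ?A" using subspace_sums[OF subspace_span M] by simp
  moreover have "bracket a b \<in> ?M" if ab: "a \<in> ?A" "b \<in> ?A" for a b
  proof -
    obtain \<alpha> m \<beta> m' where a: "a = scale \<alpha> x + m" "m \<in> ?M" and b: "b = scale \<beta> x + m'" "m' \<in> ?M"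
      using ab by blast
    \<comment> \<open>The summand \<open>m'\<close> of \<open>b\<close> vanishes as a right factor;
      what remains is a combination of a square and of a bracket with left factor \<open>m\<close>,
      both in \<open>?M\<close>.\<close>
    have "bracket a b = scale \<beta> (scale \<alpha> (bracket x x) + bracket m x)"
      using b unfolding a b right_annihilator_def
      by (simp add: bracket_add_right bracket_scale_right bracket_add_left bracket_scale_left)
    also have "\<dots> \<in> ?M"
      using bracket_self_annihilator bracket_annihilator[OF a(2)] M
      by (intro subspace_scale subspace_add)
    finally show ?thesis .
  qed
  ultimately have "subalgebra ?A" using MA unfolding subalgebra_def by (meson subsetD)
  moreover have "x \<in> ?A" using subspace_0[OF M] by (intro CollectI exI[of _ 1] exI[of _ 0]) simp
  ultimately have "?A = UNIV" by (rule subalgebra_generator)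
  then have "a \<in> ?A" by simp
  then show ?thesis by blast
qed

lemma dim_le_Suc_annihilator: "dim (UNIV :: 'b set) \<le> Suc (dim right_annihilator)"
proof -
  have "UNIV \<subseteq> span (insert x right_annihilator)"
  proof
    fix a :: 'b
    obtain \<beta> m where "m \<in> right_annihilator" "a = scale \<beta> x + m"
      using generator_annihilator_decomposition by blast
    then show "a \<in> span (insert x right_annihilator)"
      by (simp add: span_add span_scale span_base)
  qed
  then have "dim (UNIV :: 'b set) \<le> dim (insert x right_annihilator)"
    by (metis dim_span dim_subset)
  also have "\<dots> \<le> Suc (dim right_annihilator)" by (simp add: dim_insert)
  finally show ?thesis .
qed

text \<open>The lower bound on the length of the lattice of subalgebras, stated through an arbitrary
  strictly monotone map so that it can be fed with the lattice isomorphism.\<close>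

lemma dim_le_strict_mono:
  fixes dim' :: "'c set \<Rightarrow> nat"
  assumes mono: "\<And>A B. subalgebra A \<Longrightarrow> subalgebra B \<Longrightarrow> A \<subset> B \<Longrightarrow> dim' (\<theta> A) < dim' (\<theta> B)"
  shows "dim (UNIV :: 'b set) \<le> dim' (\<theta> UNIV)"
proof -
  let ?M = right_annihilator
  \<comment> \<open>Adding independent vectors of \<open>?M\<close> one at a time gives a strictly
    increasing chain of subspaces of \<open>?M\<close>, each of them a subalgebra.\<close>
  have step: "card B \<le> dim' (\<theta> (span B))" if "finite B" "independent B" "B \<subseteq> ?M" for B
    using that
  proof (induction B rule: finite_induct)
    case empty
    then show ?case by simp
  next
    case (insert b B)
    have "b \<notin> span B" using insert by (simp add: independent_insert)
    then have "span B \<subset> span (insert b B)"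
      using span_mono[of B "insert b B"] span_base[of b "insert b B"] by blast
    moreover have "span C \<subseteq> ?M" if "C \<subseteq> ?M" for C
      using that subspace_right_annihilator by (rule span_minimal)
    ultimately have "dim' (\<theta> (span B)) < dim' (\<theta> (span (insert b B)))"
      using insert.prems
      by (intro mono subalgebra_subspace_right_annihilator subspace_span) auto
    moreover have "card B \<le> dim' (\<theta> (span B))"
      using insert by (simp add: independent_insert)
    ultimately show ?case using insert.hyps by simp
  qed
  obtain B where B: "B \<subseteq> ?M" "independent B" "?M \<subseteq> span B" "card B = dim ?M"
    using basis_exists by blast
  have "span B = ?M" using B span_minimal[OF B(1) subspace_right_annihilator] by blast
  then have M: "dim ?M \<le> dim' (\<theta> ?M)"
    using step[of B] B finiteI_independent by auto
  show ?thesis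
  proof (cases "?M = UNIV")
    case True
    with M show ?thesis by simp
  next
    case False
    \<comment> \<open>The strict inclusion of \<open>?M\<close> in \<open>UNIV\<close> supplies the
      one dimension that \<open>?M\<close> may lack.\<close>
    then have "dim' (\<theta> ?M) < dim' (\<theta> UNIV)"
      by (intro mono subalgebra_UNIV subalgebra_subspace_right_annihilator
          subspace_right_annihilator) auto
    then show ?thesis using M dim_le_Suc_annihilator by simp
  qed
qed

section \<open>Invariant subspaces and polynomials in right multiplication by the generator\<close>

definition invariant_subspace :: "'b set \<Rightarrow> bool" where
  "invariant_subspace N \<longleftrightarrow> subspace N \<and> (\<forall>a\<in>N. bracket a x \<in> N)"

text \<open>The annihilator part of \<open>b\<close> contributes nothing, and its coefficient at
  \<open>x\<close> serves all \<open>a\<close> at once.\<close>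

lemma bracket_generator_multiple: "\<exists>\<beta>. \<forall>a. bracket a b = scale \<beta> (bracket a x)"
proof -
  obtain \<beta> m where m: "m \<in> right_annihilator" "b = scale \<beta> x + m"
    using generator_annihilator_decomposition by blast
  then have "bracket a b = scale \<beta> (bracket a x)" for a
    by (simp add: bracket_add_right bracket_scale_right right_annihilator_def)
  then show ?thesis by blast
qed

lemma invariant_subspace_subalgebra:
  assumes "invariant_subspace N"
  shows "subalgebra N"
proof -
  have "bracket a b \<in> N" if "a \<in> N" for a b
  proof -
    obtain \<beta> where "bracket a b = scale \<beta> (bracket a x)"
      using bracket_generator_multiple by blast
    then show ?thesis using assms that by (simp add: invariant_subspace_def subspace_scale)
  qed
  with assms show ?thesis by (simp add: invariant_subspace_def subalgebra_def)
qed

text \<open>If \<open>A\<close> contains some \<open>b\<close> outside the right annihilator,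
  bracketing with \<open>b\<close> is a nonzero multiple of bracketing with \<open>x\<close>.
  Otherwise maximality leaves two cases: \<open>A\<close> is the right annihilator, which is
  invariant, or the right annihilator is everything and all brackets vanish.\<close>

lemma maximal_subalgebra_invariant:
  assumes "maximal_subalgebra A"
  shows "invariant_subspace A"
proof (cases "A \<subseteq> right_annihilator")
  case True
  have "subalgebra right_annihilator"
    by (rule subalgebra_subspace_right_annihilator[OF subspace_right_annihilator subset_refl])
  then consider "right_annihilator = A" | "right_annihilator = UNIV"
    using True assms unfolding maximal_subalgebra_def by blast
  then show ?thesis
  proof cases
    case 1
    then show ?thesis
      using subspace_right_annihilator bracket_annihilator by (auto simp: invariant_subspace_def)
  next
    case 2
    then have "bracket a x = 0" for a by (auto simp: right_annihilator_def)
    then show ?thesis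
      using assms by (simp add: maximal_subalgebra_def subalgebra_def invariant_subspace_def subspace_0)
  qed
next
  case False
  then obtain b where b: "b \<in> A" "b \<notin> right_annihilator" by blast
  obtain \<beta> where \<beta>: "\<And>a. bracket a b = scale \<beta> (bracket a x)"
    using bracket_generator_multiple by blast
  have "\<beta> \<noteq> 0" using b(2) \<beta> by (auto simp: right_annihilator_def)
  then have "bracket a x = scale (inverse \<beta>) (bracket a b)" for a by (simp add: \<beta>)
  then show ?thesis
    using assms b(1) unfolding maximal_subalgebra_def subalgebra_def invariant_subspace_def
    by (auto intro: subspace_scale)
qed

text \<open>A bicommutant description of the polynomials in right multiplication by the generator;
  it makes commutativity immediate.\<close>

definition multiplications :: "('b \<Rightarrow> 'b) set" where
  "multiplications = {T. Vector_Spaces.linear scale scale T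
     \<and> (\<forall>S. Vector_Spaces.linear scale scale S \<and> (\<forall>v. S (bracket v x) = bracket (S v) x)
            \<longrightarrow> (\<forall>v. T (S v) = S (T v)))
     \<and> (\<forall>N. invariant_subspace N \<longrightarrow> T ` N \<subseteq> N)}"

lemma multiplications_linear: "T \<in> multiplications \<Longrightarrow> Vector_Spaces.linear scale scale T"
  by (simp add: multiplications_def)

lemma multiplications_add: "T \<in> multiplications \<Longrightarrow> T (u + v) = T u + T v"
  by (simp add: multiplications_def linear_self_iff)

lemma multiplications_scale: "T \<in> multiplications \<Longrightarrow> T (scale c u) = scale c (T u)"
  by (simp add: multiplications_def linear_self_iff)

lemma multiplications_invariant:
  "T \<in> multiplications \<Longrightarrow> invariant_subspace N \<Longrightarrow> v \<in> N \<Longrightarrow> T v \<in> N"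
  unfolding multiplications_def by blast

lemma multiplications_bicommutant:
  assumes "T \<in> multiplications" "Vector_Spaces.linear scale scale S"
    "\<And>v. S (bracket v x) = bracket (S v) x"
  shows "T (S v) = S (T v)"
  using assms by (simp add: multiplications_def)

lemma multiplicationsI:
  assumes "\<And>u v. T (u + v) = T u + T v" "\<And>c u. T (scale c u) = scale c (T u)"
    and "\<And>S v. Vector_Spaces.linear scale scale S \<Longrightarrow> (\<And>v. S (bracket v x) = bracket (S v) x)
           \<Longrightarrow> T (S v) = S (T v)"
    and "\<And>N v. invariant_subspace N \<Longrightarrow> v \<in> N \<Longrightarrow> T v \<in> N"
  shows "T \<in> multiplications"
  using assms unfolding multiplications_def linear_self_iff by blast

lemma id_in_multiplications: "(\<lambda>v. v) \<in> multiplications"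
  by (rule multiplicationsI) simp_all

text \<open>Right multiplication by \<open>x\<close> commutes with itself, so it is an admissible
  \<open>S\<close> in the bicommutant condition. Hence every multiplication is in turn admissible,
  and any two of them commute.\<close>

lemma multiplications_commute_bracket:
  assumes "T \<in> multiplications"
  shows "T (bracket v x) = bracket (T v) x"
  using assms linear_left[of x] by (rule multiplications_bicommutant) simp

lemma multiplications_commute:
  assumes "T \<in> multiplications" "S \<in> multiplications"
  shows "T (S v) = S (T v)"
  using assms(1) multiplications_linear[OF assms(2)] multiplications_commute_bracket[OF assms(2)]
  by (rule multiplications_bicommutant)

lemma multiplications_closed_add:
  assumes "T \<in> multiplications" "S \<in> multiplications"
  shows "(\<lambda>v. T v + S v) \<in> multiplications"
  by (rule multiplicationsI)
    (use assms in \<open>simp_all add: multiplications_add multiplications_scale scale_right_distrib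
      multiplications_bicommutant multiplications_invariant linear_self_iff
      invariant_subspace_def subspace_add\<close>)

lemma multiplications_closed_scale:
  assumes "T \<in> multiplications"
  shows "(\<lambda>v. scale c (T v)) \<in> multiplications"
  by (rule multiplicationsI)
    (use assms in \<open>simp_all add: multiplications_add multiplications_scale scale_right_distrib
      multiplications_bicommutant multiplications_invariant linear_self_iff mult.commute
      invariant_subspace_def subspace_scale\<close>)

lemma multiplications_closed_bracket:
  assumes "T \<in> multiplications"
  shows "(\<lambda>v. bracket (T v) x) \<in> multiplications"
  by (rule multiplicationsI)
    (use assms in \<open>simp_all add: multiplications_add multiplications_scale bracket_add_left
      bracket_scale_left multiplications_bicommutant multiplications_invariant
      invariant_subspace_def\<close>)

lemma multiplications_closed_compose:
  assumes T: "T \<in> multiplications" and S: "S \<in> multiplications"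
  shows "(\<lambda>v. T (S v)) \<in> multiplications"
proof (rule multiplicationsI)
  fix U v
  assume "Vector_Spaces.linear scale scale U" "\<And>v. U (bracket v x) = bracket (U v) x"
  note U = this
  show "T (S (U v)) = U (T (S v))"
    by (simp only: multiplications_bicommutant[OF S U] multiplications_bicommutant[OF T U])
qed (use assms in \<open>simp_all add: multiplications_add multiplications_scale multiplications_invariant\<close>)

lemma orbit_self: "a \<in> {T a |T. T \<in> multiplications}"
  by (intro CollectI exI[of _ "\<lambda>v. v"]) (simp add: id_in_multiplications)

text \<open>This orbit is the cyclic submodule generated by \<open>a\<close>; closure under sums,
  multiples and right multiplication by \<open>x\<close> comes from the same closure of
  \<open>multiplications\<close>.\<close>

lemma invariant_orbit: "invariant_subspace {T a |T. T \<in> multiplications}"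
proof -
  define Q where "Q = {T a |T. T \<in> multiplications}"
  have I: "T a \<in> Q" if "T \<in> multiplications" for T
    using that unfolding Q_def by blast
  have "0 \<in> Q"
    \<comment> \<open>The zero map arises as the identity scaled by 0.\<close>
    using I[OF multiplications_closed_scale[OF id_in_multiplications, of 0]] by simp
  moreover have "u + v \<in> Q" if uv: "u \<in> Q" "v \<in> Q" for u v
  proof -
    obtain T S where "T \<in> multiplications" "S \<in> multiplications" "u = T a" "v = S a"
      using uv unfolding Q_def by blast
    then show ?thesis using I[OF multiplications_closed_add[of T S]] by simp
  qed
  moreover have "scale c u \<in> Q \<and> bracket u x \<in> Q" if u: "u \<in> Q" for c u
  proof -
    obtain T where "T \<in> multiplications" "u = T a" using u unfolding Q_def by blast
    then show ?thesis
      using I[OF multiplications_closed_scale[of T c]] I[OF multiplications_closed_bracket[of T]]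
      by simp
  qed
  ultimately have "invariant_subspace Q"
    unfolding invariant_subspace_def subspace_def by simp
  then show ?thesis by (simp only: Q_def)
qed

text \<open>Turns elements into operators: the orbit of \<open>x\<close> is a subalgebra containing
  \<open>x\<close>, hence everything.\<close>

lemma orbit_generator: "\<exists>T\<in>multiplications. a = T x"
proof -
  have "{T x |T. T \<in> multiplications} = UNIV"
    by (rule subalgebra_generator[OF invariant_subspace_subalgebra[OF invariant_orbit] orbit_self])
  then have "a \<in> {T x |T. T \<in> multiplications}" by (rule ssubst) (rule UNIV_I)
  then show ?thesis by blast
qed

section \<open>Finiteness of the set of maximal subalgebras\<close>

text \<open>The analogue of "maximal ideals are prime" in a commutative ring. The orbit of
  \<open>S x\<close> together with \<open>N\<close> spans everything, so
  \<open>x = U (S x) + n\<close>; applying \<open>T\<close> would put \<open>T x\<close> into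
  \<open>N\<close> if \<open>T (S x)\<close> were there.\<close>

lemma maximal_subalgebra_prime:
  assumes N: "maximal_subalgebra N" and T: "T \<in> multiplications" and S: "S \<in> multiplications"
    and "T x \<notin> N" "S x \<notin> N"
  shows "T (S x) \<notin> N"
proof
  assume TS: "T (S x) \<in> N"
  note inv = maximal_subalgebra_invariant[OF N]
  define Q where "Q = {U (S x) |U. U \<in> multiplications}"
  define K where "K = {u + n |u n. u \<in> Q \<and> n \<in> N}"
  have Q: "invariant_subspace Q" unfolding Q_def by (rule invariant_orbit)
  have "subspace K"
    using Q inv unfolding K_def by (intro subspace_sums) (simp_all add: invariant_subspace_def)
  moreover have "bracket a x \<in> K" if "a \<in> K" for a
    using that Q inv unfolding K_def invariant_subspace_def mem_Collect_eq
    by (metis bracket_add_left)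
  ultimately have K: "subalgebra K"
    by (intro invariant_subspace_subalgebra) (simp add: invariant_subspace_def)
  have 0: "0 \<in> Q" "0 \<in> N" using Q inv by (simp_all add: invariant_subspace_def subspace_0)
  have "N \<subseteq> K" using 0(1) unfolding K_def by force
  moreover have "S x \<in> Q" unfolding Q_def by (rule orbit_self)
  then have "S x \<in> K" using 0(2) unfolding K_def by force
  ultimately have "K = UNIV" using N K \<open>S x \<notin> N\<close> unfolding maximal_subalgebra_def by blast
  then have "x \<in> K" by simp
  then obtain u n where un: "u \<in> Q" "n \<in> N" "x = u + n"
    unfolding K_def mem_Collect_eq by (elim exE conjE) (rule that)
  obtain U where U: "U \<in> multiplications" "u = U (S x)"
    using un(1) unfolding Q_def mem_Collect_eq by (elim exE conjE) (rule that)
  have "T x = T u + T n"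
    using arg_cong[OF un(3), of T] unfolding multiplications_add[OF T] .
  also have "T u = U (T (S x))" unfolding U(2) by (rule multiplications_commute[OF T U(1)])
  finally have "T x = U (T (S x)) + T n" .
  moreover have "U (T (S x)) \<in> N" by (rule multiplications_invariant[OF U(1) inv TS])
  moreover have "T n \<in> N" by (rule multiplications_invariant[OF T inv un(2)])
  ultimately have "T x \<in> N" using inv by (simp add: invariant_subspace_def subspace_add)
  with \<open>T x \<notin> N\<close> show False ..
qed

text \<open>As with products of elements of distinct maximal ideals: each \<open>A\<close> in the
  family contains some \<open>S x\<close> outside \<open>N\<close>, and composing these operators
  keeps the result outside \<open>N\<close> by primality.\<close>

lemma maximal_subalgebra_avoidance:
  assumes "finite \<F>" "\<And>A. A \<in> \<F> \<Longrightarrow> maximal_subalgebra A" "maximal_subalgebra N" "N \<notin> \<F>"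
  shows "\<exists>T\<in>multiplications. T x \<notin> N \<and> T x \<in> \<Inter>\<F>"
  using assms(1,2,4)
proof (induction \<F> rule: finite_induct)
  case empty
  have "x \<notin> N" using assms(3) subalgebra_generator by (auto simp: maximal_subalgebra_def)
  then show ?case using id_in_multiplications by (intro bexI[of _ "\<lambda>v. v"]) simp_all
next
  case (insert A \<F>)
  then obtain T where T: "T \<in> multiplications" "T x \<notin> N" "T x \<in> \<Inter>\<F>" by auto
  have A: "maximal_subalgebra A" "A \<noteq> N" using insert.prems by auto
  then have "\<not> A \<subseteq> N" using assms(3) unfolding maximal_subalgebra_def by blast
  then obtain a where a: "a \<in> A" "a \<notin> N" by blast
  obtain S where S: "S \<in> multiplications" "a = S x"
    using orbit_generator[of a] by (elim bexE) (rule that)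
  with a have Sx: "S x \<in> A" "S x \<notin> N" by simp_all
  have "T (S x) \<in> A"
    using multiplications_invariant[OF T(1) maximal_subalgebra_invariant[OF A(1)] Sx(1)] .
  \<comment> \<open>Commutativity makes this the same element as \<open>T (S x)\<close>, so it lies
    in the new \<open>A\<close> and in all earlier members.\<close>
  moreover have "S (T x) \<in> B" if "B \<in> \<F>" for B
    using insert.prems(1) T(3) that
    by (intro multiplications_invariant[OF S(1)] maximal_subalgebra_invariant) simp_all
  ultimately have "T (S x) \<in> \<Inter>(insert A \<F>)"
    using multiplications_commute[OF T(1) S(1)] by simp
  moreover have "T (S x) \<notin> N" by (rule maximal_subalgebra_prime[OF assms(3) T(1) S(1) T(2) Sx(2)])
  ultimately show ?case
    by (intro bexI[OF _ multiplications_closed_compose[OF T(1) S(1)]]) simp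
qed

text \<open>By avoidance, each further maximal subalgebra strictly lowers the dimension of the
  intersection, which starts at \<open>UNIV\<close> for the empty family.\<close>

lemma card_maximal_subalgebras:
  assumes "finite \<F>" "\<And>A. A \<in> \<F> \<Longrightarrow> maximal_subalgebra A"
  shows "card \<F> + dim (\<Inter>\<F>) \<le> dim (UNIV :: 'b set)"
  using assms
proof (induction \<F> rule: finite_induct)
  case empty
  then show ?case by simp
next
  case (insert A \<F>)
  have maximal: "maximal_subalgebra B" if "B \<in> insert A \<F>" for B
    using insert.prems that by blast
  have "\<exists>T\<in>multiplications. T x \<notin> A \<and> T x \<in> \<Inter>\<F>"
    using insert.hyps by (intro maximal_subalgebra_avoidance) (simp_all add: maximal)
  then have "\<not> \<Inter>\<F> \<subseteq> A" by (meson subsetD)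
  moreover have "\<Inter>(insert A \<F>) = A \<inter> \<Inter>\<F>" by simp
  ultimately have psub: "\<Inter>(insert A \<F>) \<subset> \<Inter>\<F>" by (metis inf.cobounded1 inf_le2 psubsetI)
  have "\<forall>B\<in>insert A \<F>. subspace B"
    using maximal by (simp add: maximal_subalgebra_def subalgebra_def)
  then have "subspace (\<Inter>(insert A \<F>))" "subspace (\<Inter>\<F>)"
    by (intro subspace_Inter; simp)+
  then have "dim (\<Inter>(insert A \<F>)) < dim (\<Inter>\<F>)"
    using psub by (rule subspace_dim_psubset)
  moreover have "card \<F> + dim (\<Inter>\<F>) \<le> dim (UNIV :: 'b set)"
    using maximal by (intro insert.IH) simp
  ultimately show ?case using insert.hyps by simp
qed

lemma finite_maximal_subalgebras: "finite {A. maximal_subalgebra A}"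
proof (rule ccontr)
  assume "infinite {A. maximal_subalgebra A}"
  then obtain \<F> where "\<F> \<subseteq> {A. maximal_subalgebra A}" "finite \<F>" "card \<F> = Suc (dim (UNIV :: 'b set))"
    using infinite_arbitrarily_large by metis
  then show False using card_maximal_subalgebras[of \<F>] by auto
qed

end

section \<open>Transport along a lattice isomorphism\<close>

context leibniz_algebra_pair
begin

text \<open>Inclusion is the equation \<open>A \<inter> B = A\<close>, which an injective map
  preserving intersections respects in both directions.\<close>

lemma lattice_isomorphism_subset_iff:
  assumes "lattice_isomorphism \<theta>" "L1.subalgebra A" "L1.subalgebra B"
  shows "\<theta> A \<subseteq> \<theta> B \<longleftrightarrow> A \<subseteq> B"
proof -
  have "inj_on \<theta> {A. L1.subalgebra A}" "\<theta> (A \<inter> B) = \<theta> A \<inter> \<theta> B"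
    using assms by (auto simp: lattice_isomorphism_def bij_betw_def)
  then show ?thesis
    using assms(2,3) L1.subalgebra_Int[of A B] unfolding inj_on_def
    by (metis inf.absorb_iff1 mem_Collect_eq)
qed

lemma lattice_isomorphism_subalgebra:
  assumes "lattice_isomorphism \<theta>" "L1.subalgebra A"
  shows "L2.subalgebra (\<theta> A)"
  using assms by (auto simp: lattice_isomorphism_def bij_betw_def)

lemma lattice_isomorphism_surj:
  assumes "lattice_isomorphism \<theta>" "L2.subalgebra B"
  obtains A where "L1.subalgebra A" "\<theta> A = B"
proof -
  have "B \<in> \<theta> ` {A. L1.subalgebra A}"
    using assms by (simp add: lattice_isomorphism_def bij_betw_def)
  then show thesis using that by auto
qed

lemma lattice_isomorphism_UNIV:
  assumes "lattice_isomorphism \<theta>"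
  shows "\<theta> UNIV = UNIV"
proof -
  obtain A where A: "L1.subalgebra A" "\<theta> A = UNIV"
    using lattice_isomorphism_surj[OF assms L2.subalgebra_UNIV] .
  then show ?thesis
    using lattice_isomorphism_subset_iff[OF assms A(1) L1.subalgebra_UNIV] by auto
qed

text \<open>This direction bounds the maximal subalgebras of the second algebra by those of the
  first, as finiteness requires.\<close>

lemma lattice_isomorphism_maximal:
  assumes \<theta>: "lattice_isomorphism \<theta>" and "L2.maximal_subalgebra B"
  shows "B \<in> \<theta> ` {A. L1.maximal_subalgebra A}"
proof -
  have B: "L2.subalgebra B" "B \<noteq> UNIV"
    "\<And>C. L2.subalgebra C \<Longrightarrow> B \<subseteq> C \<Longrightarrow> C = B \<or> C = UNIV"
    using assms(2) by (auto simp: L2.maximal_subalgebra_def)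
  obtain A where A: "L1.subalgebra A" "\<theta> A = B"
    using lattice_isomorphism_surj[OF \<theta> B(1)] .
  note sub = lattice_isomorphism_subset_iff[OF \<theta>]
  have "C = A \<or> C = UNIV" if "L1.subalgebra C" "A \<subseteq> C" for C
  proof -
    have "\<theta> C = \<theta> A \<or> \<theta> C = \<theta> UNIV"
      using B(3)[OF lattice_isomorphism_subalgebra[OF \<theta> that(1)]] sub[OF A(1) that(1)] that(2) A(2)
        lattice_isomorphism_UNIV[OF \<theta>] by auto
    then show ?thesis
      using sub[OF that(1) A(1)] sub[OF L1.subalgebra_UNIV that(1)] that(2) by blast
  qed
  moreover have "A \<noteq> UNIV" using B(2) A(2) lattice_isomorphism_UNIV[OF \<theta>] by auto
  ultimately have "L1.maximal_subalgebra A" using A(1) by (auto simp: L1.maximal_subalgebra_def)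
  with A(2) show ?thesis by blast
qed

lemma lattice_isomorphism_inverse:
  assumes \<theta>: "lattice_isomorphism \<theta>"
  shows "\<exists>\<phi>. \<forall>B. L2.subalgebra B \<longrightarrow> L1.subalgebra (\<phi> B) \<and> \<theta> (\<phi> B) = B"
  using lattice_isomorphism_surj[OF \<theta>] by (intro choice) blast

end

theorem theorem2p3:
  fixes scale :: "'f::field \<Rightarrow> 'a::ab_group_add \<Rightarrow> 'a" and bracket :: "'a \<Rightarrow> 'a \<Rightarrow> 'a"
    and scale' :: "'f \<Rightarrow> 'b::ab_group_add \<Rightarrow> 'b" and bracket' :: "'b \<Rightarrow> 'b \<Rightarrow> 'b"
  assumes "infinite (UNIV :: 'f set)"
    and "leibniz_algebra scale bracket"
    and "\<exists>B. finite_dimensional_vector_space scale B"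
    and "leibniz_algebra.cyclic scale bracket"
    and "leibniz_algebra scale' bracket'"
    and "\<exists>B. finite_dimensional_vector_space scale' B"
    and "\<exists>\<theta>. leibniz_algebra_pair.lattice_isomorphism scale bracket scale' bracket' \<theta>"
  shows "leibniz_algebra.cyclic scale' bracket' \<and>
         vector_space.dim scale' (UNIV :: 'b set) = vector_space.dim scale (UNIV :: 'a set)"
proof -
  obtain B where B: "finite_dimensional_vector_space scale B" using assms(3) by blast
  obtain B' where B': "finite_dimensional_vector_space scale' B'" using assms(6) by blast
  obtain x where "leibniz_algebra.generated scale bracket {x} = UNIV"
    using assms(4) leibniz_algebra.cyclic_def[OF assms(2)] by blast
  then interpret L: cyclic_leibniz_algebra scale bracket B x
    using assms(2) B
    by (simp add: cyclic_leibniz_algebra_def finite_dimensional_leibniz_algebra_def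
        cyclic_leibniz_algebra_axioms_def)
  interpret L': finite_dimensional_leibniz_algebra scale' bracket' B'
    using assms(5) B' by (simp add: finite_dimensional_leibniz_algebra_def)
  interpret leibniz_algebra_pair scale bracket scale' bracket'
    by unfold_locales
  obtain \<theta> where \<theta>: "lattice_isomorphism \<theta>" using assms(7) by blast
  have "finite {A. L'.maximal_subalgebra A}"
  proof (rule finite_subset)
    show "{A. L'.maximal_subalgebra A} \<subseteq> \<theta> ` {A. L.maximal_subalgebra A}"
      using lattice_isomorphism_maximal[OF \<theta>] by (intro subsetI) (simp only: mem_Collect_eq)
  qed (intro finite_imageI L.finite_maximal_subalgebras)
  with assms(1) have cyc: "L'.cyclic" by (rule L'.cyclic_if_finite_maximal_subalgebras)
  then obtain y where "L'.generated {y} = UNIV" unfolding L'.cyclic_def by blast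
  \<comment> \<open>Once the second algebra is known to be cyclic, the length bound applies to it
    too, and the dimensions can be compared both ways.\<close>
  then interpret C: cyclic_leibniz_algebra scale' bracket' B' y
    by unfold_locales
  have mono: "\<theta> A \<subset> \<theta> A' \<longleftrightarrow> A \<subset> A'" if "L.subalgebra A" "L.subalgebra A'" for A A'
    using lattice_isomorphism_subset_iff[OF \<theta>] that by (auto simp: less_le_not_le)
  note sub = lattice_isomorphism_subalgebra[OF \<theta>]
  have "L.dim UNIV \<le> L'.dim (\<theta> UNIV)"
  proof (rule L.dim_le_strict_mono)
    fix A A' assume "L.subalgebra A" "L.subalgebra A'" "A \<subset> A'"
    then show "L'.dim (\<theta> A) < L'.dim (\<theta> A')"
      using mono sub by (intro L'.subspace_dim_psubset) (auto simp: L'.subalgebra_def)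
  qed
  moreover obtain \<phi> where \<phi>: "\<And>B. L'.subalgebra B \<Longrightarrow> L.subalgebra (\<phi> B) \<and> \<theta> (\<phi> B) = B"
    using lattice_isomorphism_inverse[OF \<theta>] by blast
  have "L'.dim UNIV \<le> L.dim (\<phi> UNIV)"
  proof (rule C.dim_le_strict_mono)
    fix A A' assume "L'.subalgebra A" "L'.subalgebra A'" "A \<subset> A'"
    then show "L.dim (\<phi> A) < L.dim (\<phi> A')"
      \<comment> \<open>Since \<open>\<theta>\<close> maps \<open>\<phi> A\<close> back to
        \<open>A\<close>, \<open>mono\<close> read from left to right shows that
        \<open>\<phi>\<close> is strictly monotone.\<close>
      using mono[of "\<phi> A" "\<phi> A'"] \<phi>[of A] \<phi>[of A']
      by (intro L.subspace_dim_psubset) (auto simp: L.subalgebra_def)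
  qed
  moreover have "L.dim (\<phi> UNIV) \<le> L.dim UNIV" by (intro L.dim_subset) simp
  moreover have "L'.dim (\<theta> UNIV) \<le> L'.dim UNIV" by (intro L'.dim_subset) simp
  ultimately show ?thesis using cyc by simp
qed

end
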